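(* Let $G$ be a subgroup of the symmetric group $S_3$. Then any $G$-Hom-associative color algebra $(L,\mu,\zeta)$ is Hom-Lie color admissible.
   Context: Throughout, $\mathbb{F}$ is a field of characteristic zero, $\Gamma$ is an abelian group (written additively), and all vector spaces are over $\mathbb{F}$. A $\Gamma$-graded vector space is $V=\bigoplus_{\alpha\in\Gamma}V_\alpha$; $\bar x$ denotes the degree of a homogeneous element $x$, and $\mathcal{H}(V)$ the set of homogeneous elements. A linear map is even if it preserves degrees; a bilinear product is even if it maps $V_\alpha\times V_\beta$ into $V_{\alpha+\beta}$. A bi-character on $\Gamma$ is a map $\varepsilon:\Gamma\times\Gamma\to\mathbb{F}^*$ with $\varepsilon(\alpha,\beta)\varepsilon(\beta,\alpha)=1$, $\varepsilon(\alpha,\beta+\gamma)=\varepsilon(\alpha,\beta)\varepsilon(\alpha,\gamma)$, $\varepsilon(\alpha+\beta,\gamma)=\varepsilon(\alpha,\gamma)\varepsilon(\beta,\gamma)$. A bi-character $\varepsilon$ on $\Gamma$ is fixed, and $\varepsilon(x,y)=\varepsilon(\bar x,\bar y)$ for homogeneous $x,y$. Here a Hom-color algebra $(L,\mu,\zeta)$ consists of a $\Gamma$-graded space $L$, an even bilinear map $\mu:L\times L\to L$ (no associativity-type condition is imposed), and an even algebra endomorphism $\zeta:L\to L$ (i.e. $\zeta(\mu(x,y))=\mu(\zeta(x),\zeta(y))$). Its color commutator is the bilinear bracket determined by $[x,y]=\mu(x,y)-\varepsilon(x,y)\mu(y,x)$ for $x,y\in\mathcal{H}(L)$. It is Hom-Lie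 color admissible if $\varepsilon(z,x)[\zeta(x),[y,z]]+\varepsilon(x,y)[\zeta(y),[z,x]]+\varepsilon(y,z)[\zeta(z),[x,y]]=0$ for all $x,y,z\in\mathcal{H}(L)$. The $\zeta$-associator is $a_{\mu,\zeta}(x,y,z)=\mu(\zeta(x),\mu(y,z))-\mu(\mu(x,y),\zeta(z))$. Let $\sigma_1=(1\,2)$, $\sigma_2=(2\,3)$ generate $S_3$, acting on triples by exchanging positions: $\sigma_1(x_1,x_2,x_3)=(x_2,x_1,x_3)$, $\sigma_2(x_1,x_2,x_3)=(x_1,x_3,x_2)$, with a composition acting by successive application, $(\sigma_i\circ\sigma_j)(x_1,x_2,x_3)=\sigma_i(\sigma_j(x_1,x_2,x_3))$. The parity is defined by $|\mathrm{id}(x_1,x_2,x_3)|=1$, $|\sigma_i(x_1,x_2,x_3)|=\varepsilon(x_i,x_{i+1})$, and $|\sigma_i\circ\sigma_j(x_1,x_2,x_3)|=|\sigma_j(x_1,x_2,x_3)|\cdot|\sigma_i(\sigma_j(x_1,x_2,x_3))|$, extended inductively. Explicitly: $\mathrm{id}$ gives $(x_1,x_2,x_3)$ with parity $1$; $\sigma_1$ gives $(x_2,x_1,x_3)$ with parity $\varepsilon(x_1,x_2)$; $\sigma_2$ gives $(x_1,x_3,x_2)$ with parity $\varepsilon(x_2,x_3)$; $\sigma_1\circ\sigma_2$ gives $(x_3,x_1,x_2)$ with parity $\varepsilon(x_2,x_3)\varepsilon(x_1,x_3)$; $\sigma_2\circ\sigma_1$ gives $(x_2,x_3,x_1)$ with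 parity $\varepsilon(x_1,x_2)\varepsilon(x_1,x_3)$; $\sigma_2\circ\sigma_1\circ\sigma_2$ gives $(x_3,x_2,x_1)$ with parity $\varepsilon(x_2,x_3)\varepsilon(x_1,x_3)\varepsilon(x_1,x_2)$. The sign $(-1)^{\mathrm{sgn}(\sigma)}$ is $+1$ for even and $-1$ for odd permutations. For a subgroup $G\le S_3$, a Hom-color algebra $(L,\mu,\zeta)$ is called $G$-Hom-associative (a $G$-Hom-associative color algebra) if $\sum_{\sigma\in G}(-1)^{\mathrm{sgn}(\sigma)}|\sigma(x_1,x_2,x_3)|\,a_{\mu,\zeta}(\sigma(x_1,x_2,x_3))=0$ for all $x_1,x_2,x_3\in\mathcal{H}(L)$. *)

theory Defs
  imports Complex_Main "HOL-Algebra.Sym_Groups" "HOL-Combinatorics.Permutations"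
begin

section \<open>Graded spaces, bi-characters and Hom-color algebras\<close>

locale bicharacter =
  fixes \<epsilon> :: "'g::ab_group_add \<Rightarrow> 'g \<Rightarrow> 'f::field"
  assumes nonzero: "\<epsilon> \<alpha> \<beta> \<noteq> 0"
    and skew: "\<epsilon> \<alpha> \<beta> * \<epsilon> \<beta> \<alpha> = 1"
    and add_right: "\<epsilon> \<alpha> (\<beta> + \<gamma>) = \<epsilon> \<alpha> \<beta> * \<epsilon> \<alpha> \<gamma>"
    and add_left: "\<epsilon> (\<alpha> + \<beta>) \<gamma> = \<epsilon> \<alpha> \<gamma> * \<epsilon> \<beta> \<gamma>"

definition is_decomposition :: "('g \<Rightarrow> 'v::ab_group_add set) \<Rightarrow> 'v \<Rightarrow> ('g \<Rightarrow> 'v) \<Rightarrow> bool" where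
  "is_decomposition V v f \<longleftrightarrow>
     (\<forall>\<alpha>. f \<alpha> \<in> V \<alpha>) \<and> finite {\<alpha>. f \<alpha> \<noteq> 0} \<and> v = (\<Sum>\<alpha> | f \<alpha> \<noteq> 0. f \<alpha>)"

locale graded_vector_space = vector_space scale
  for scale :: "'f::field_char_0 \<Rightarrow> 'v::ab_group_add \<Rightarrow> 'v" +
  fixes V :: "'g::ab_group_add \<Rightarrow> 'v set"
  assumes subspace_component: "subspace (V \<alpha>)"
    and direct_sum: "\<exists>!f. is_decomposition V v f"

definition bilinear_map :: "('f::field \<Rightarrow> 'v::ab_group_add \<Rightarrow> 'v) \<Rightarrow> ('v \<Rightarrow> 'v \<Rightarrow> 'v) \<Rightarrow> bool" where
  "bilinear_map scale b \<longleftrightarrow>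
     (\<forall>x. Vector_Spaces.linear scale scale (b x)) \<and>
     (\<forall>y. Vector_Spaces.linear scale scale (\<lambda>x. b x y))"

locale hom_color_algebra = graded_vector_space scale V
  for scale :: "'f::field_char_0 \<Rightarrow> 'v::ab_group_add \<Rightarrow> 'v"
    and V :: "'g::ab_group_add \<Rightarrow> 'v set" +
  fixes \<mu> :: "'v \<Rightarrow> 'v \<Rightarrow> 'v" and \<zeta> :: "'v \<Rightarrow> 'v"
  assumes mu_bilinear: "bilinear_map scale \<mu>"
    and mu_even: "x \<in> V \<alpha> \<Longrightarrow> y \<in> V \<beta> \<Longrightarrow> \<mu> x y \<in> V (\<alpha> + \<beta>)"
    and zeta_linear: "Vector_Spaces.linear scale scale \<zeta>"
    and zeta_even: "x \<in> V \<alpha> \<Longrightarrow> \<zeta> x \<in> V \<alpha>"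
    and zeta_mult: "\<zeta> (\<mu> x y) = \<mu> (\<zeta> x) (\<zeta> y)"


section \<open>The color commutator\<close>

definition homogeneous_part :: "('g \<Rightarrow> 'v::ab_group_add set) \<Rightarrow> 'v \<Rightarrow> 'g \<Rightarrow> 'v" where
  "homogeneous_part V v = (THE f. is_decomposition V v f)"

text \<open>The bracket is prescribed on homogeneous elements only; its bilinear extension is the sum of
  the prescribed values over the homogeneous parts of the arguments.  The lemmas
  \<open>color_commutator_homogeneous\<close>, \<open>color_commutator_bilinear\<close> and \<open>color_commutator_unique\<close> show
  that this is the unique bilinear map with the prescribed values.\<close>

definition color_commutator ::
  "('f::field \<Rightarrow> 'v::ab_group_add \<Rightarrow> 'v) \<Rightarrow> ('g \<Rightarrow> 'v set) \<Rightarrow> ('g \<Rightarrow> 'g \<Rightarrow> 'f) \<Rightarrow> ('v \<Rightarrow> 'v \<Rightarrow> 'v)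
    \<Rightarrow> 'v \<Rightarrow> 'v \<Rightarrow> 'v" where
  "color_commutator scale V \<epsilon> \<mu> x y =
     (let p = homogeneous_part V in
      \<Sum>\<alpha> | p x \<alpha> \<noteq> 0. \<Sum>\<beta> | p y \<beta> \<noteq> 0.
        \<mu> (p x \<alpha>) (p y \<beta>) - scale (\<epsilon> \<alpha> \<beta>) (\<mu> (p y \<beta>) (p x \<alpha>)))"

text \<open>Homogeneous elements are accompanied by an explicit degree, because \<open>0\<close> lies in every
  component; for \<open>0\<close> the identities below hold whichever degree is chosen.\<close>

definition hom_lie_color_admissible ::
  "('f::field \<Rightarrow> 'v::ab_group_add \<Rightarrow> 'v) \<Rightarrow> ('g \<Rightarrow> 'v set) \<Rightarrow> ('g \<Rightarrow> 'g \<Rightarrow> 'f) \<Rightarrow> ('v \<Rightarrow> 'v \<Rightarrow> 'v)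
    \<Rightarrow> ('v \<Rightarrow> 'v) \<Rightarrow> bool" where
  "hom_lie_color_admissible scale V \<epsilon> \<mu> \<zeta> \<longleftrightarrow>
     (let br = color_commutator scale V \<epsilon> \<mu> in
      \<forall>\<alpha> \<beta> \<gamma> x y z. x \<in> V \<alpha> \<longrightarrow> y \<in> V \<beta> \<longrightarrow> z \<in> V \<gamma> \<longrightarrow>
        scale (\<epsilon> \<gamma> \<alpha>) (br (\<zeta> x) (br y z)) + scale (\<epsilon> \<alpha> \<beta>) (br (\<zeta> y) (br z x))
          + scale (\<epsilon> \<beta> \<gamma>) (br (\<zeta> z) (br x y)) = 0)"


section \<open>Permutations acting on triples\<close>

text \<open>A triple is a function on positions, of which only the values at 1, 2, 3 matter.  Permutations
  move positions, hence the inverse; with this convention \<open>\<sigma> \<circ> \<tau>\<close> acts as \<open>\<tau>\<close> followed by \<open>\<sigma>\<close>.\<close>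

definition act :: "(nat \<Rightarrow> nat) \<Rightarrow> (nat \<Rightarrow> 'a) \<Rightarrow> nat \<Rightarrow> 'a" where
  "act \<sigma> x = (\<lambda>i. x (Hilbert_Choice.inv \<sigma> i))"

definition adj :: "nat \<Rightarrow> nat \<Rightarrow> nat" where
  "adj i = Transposition.transpose i (i + 1)"

text \<open>The parity is defined inductively along words in the generators \<open>adj 1\<close>, \<open>adj 2\<close>; for a
  bi-character it does not depend on the word, see \<open>parity_table\<close>.  The argument \<open>d\<close> is the
  triple of degrees.\<close>

inductive has_parity :: "('g \<Rightarrow> 'g \<Rightarrow> 'f::field) \<Rightarrow> (nat \<Rightarrow> 'g) \<Rightarrow> (nat \<Rightarrow> nat) \<Rightarrow> 'f \<Rightarrow> bool"
  for \<epsilon> d where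
  has_parity_id: "has_parity \<epsilon> d id 1"
| has_parity_step: "has_parity \<epsilon> d \<tau> p \<Longrightarrow> i \<in> {1, 2} \<Longrightarrow>
    has_parity \<epsilon> d (adj i \<circ> \<tau>) (p * \<epsilon> (act \<tau> d i) (act \<tau> d (i + 1)))"

definition parity :: "('g \<Rightarrow> 'g \<Rightarrow> 'f::field) \<Rightarrow> (nat \<Rightarrow> nat) \<Rightarrow> (nat \<Rightarrow> 'g) \<Rightarrow> 'f" where
  "parity \<epsilon> \<sigma> d = (THE p. has_parity \<epsilon> d \<sigma> p)"


section \<open>$G$-Hom-associativity\<close>

definition hom_associator ::
  "('v::ab_group_add \<Rightarrow> 'v \<Rightarrow> 'v) \<Rightarrow> ('v \<Rightarrow> 'v) \<Rightarrow> 'v \<Rightarrow> 'v \<Rightarrow> 'v \<Rightarrow> 'v" where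
  "hom_associator \<mu> \<zeta> x y z = \<mu> (\<zeta> x) (\<mu> y z) - \<mu> (\<mu> x y) (\<zeta> z)"

definition G_hom_associative ::
  "('f::field \<Rightarrow> 'v::ab_group_add \<Rightarrow> 'v) \<Rightarrow> ('g \<Rightarrow> 'v set) \<Rightarrow> ('g \<Rightarrow> 'g \<Rightarrow> 'f) \<Rightarrow> ('v \<Rightarrow> 'v \<Rightarrow> 'v)
    \<Rightarrow> ('v \<Rightarrow> 'v) \<Rightarrow> (nat \<Rightarrow> nat) set \<Rightarrow> bool" where
  "G_hom_associative scale V \<epsilon> \<mu> \<zeta> G \<longleftrightarrow>
     (\<forall>d x. (\<forall>i\<in>{1..3}. x i \<in> V (d i)) \<longrightarrow>
        (\<Sum>\<sigma>\<in>G. scale (of_int (sign \<sigma>) * parity \<epsilon> \<sigma> d)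
           (hom_associator \<mu> \<zeta> (act \<sigma> x 1) (act \<sigma> x 2) (act \<sigma> x 3))) = 0)"


section \<open>Well-definedness\<close>

lemma bij_adj: "bij (adj i)"
  by (simp add: adj_def)

lemma inv_adj: "Hilbert_Choice.inv (adj i) = adj i"
  by (simp add: adj_def)

lemma act_id: "act id x = x"
  by (simp add: act_def)

lemma act_comp:
  assumes "bij \<sigma>" "bij \<tau>"
  shows "act (\<sigma> \<circ> \<tau>) x = act \<sigma> (act \<tau> x)"
  by (simp add: act_def o_inv_distrib[OF assms])

lemma adj_values:
  "adj 1 1 = 2" "adj 1 2 = 1" "adj 1 3 = 3" "adj 2 1 = 1" "adj 2 2 = 3" "adj 2 3 = 2"
  by (simp_all add: adj_def transpose_def)

lemma act_adj: "act (adj j) x i = x (adj j i)"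
  by (simp add: act_def inv_adj)

lemma adj_involutive: "adj i \<circ> adj i = id" "adj i \<circ> (adj i \<circ> \<tau>) = \<tau>"
  by (simp_all add: adj_def fun_eq_iff)

lemma adj_braid:
  "adj 1 \<circ> (adj 2 \<circ> adj 1) = adj 2 \<circ> (adj 1 \<circ> adj 2)"
  "adj 1 \<circ> (adj 2 \<circ> (adj 1 \<circ> adj 2)) = adj 2 \<circ> adj 1"
  by (auto simp: adj_def fun_eq_iff transpose_def)

lemma adj_distinct:
  "distinct [id, adj 1, adj 2, adj 1 \<circ> adj 2, adj 2 \<circ> adj 1, adj 2 \<circ> (adj 1 \<circ> adj 2)]"
proof -
  let ?h = "\<lambda>p::nat \<Rightarrow> nat. (p 1, p 2, p 3)"
  have "distinct (map ?h [id, adj 1, adj 2, adj 1 \<circ> adj 2, adj 2 \<circ> adj 1, adj 2 \<circ> (adj 1 \<circ> adj 2)])"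
    by (simp only: list.map comp_apply id_apply adj_values) simp
  then show ?thesis
    unfolding distinct_map by blast
qed

lemma parity_step_values:
  fixes d :: "nat \<Rightarrow> 'g"
  shows "act (adj 1) d 1 = d 2" "act (adj 1) d 2 = d 1" "act (adj 1) d 3 = d 3"
    "act (adj 2) d 1 = d 1" "act (adj 2) d 2 = d 3" "act (adj 2) d 3 = d 2"
  by (simp_all only: act_adj adj_values)

lemmas act_words = act_comp bij_adj bij_comp parity_step_values act_id

lemma act_table:
  "map (act id x) [1, 2, 3] = [x 1, x 2, x 3]"
  "map (act (adj 1) x) [1, 2, 3] = [x 2, x 1, x 3]"
  "map (act (adj 2) x) [1, 2, 3] = [x 1, x 3, x 2]"
  "map (act (adj 1 \<circ> adj 2) x) [1, 2, 3] = [x 3, x 1, x 2]"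
  "map (act (adj 2 \<circ> adj 1) x) [1, 2, 3] = [x 2, x 3, x 1]"
  "map (act (adj 2 \<circ> (adj 1 \<circ> adj 2)) x) [1, 2, 3] = [x 3, x 2, x 1]"
  by (simp_all only: list.map act_words)

lemma (in bicharacter) has_parity_cases:
  assumes "has_parity \<epsilon> d \<sigma> p"
  shows "\<sigma> = id \<and> p = 1
    \<or> \<sigma> = adj 1 \<and> p = \<epsilon> (d 1) (d 2)
    \<or> \<sigma> = adj 2 \<and> p = \<epsilon> (d 2) (d 3)
    \<or> \<sigma> = adj 1 \<circ> adj 2 \<and> p = \<epsilon> (d 2) (d 3) * \<epsilon> (d 1) (d 3)
    \<or> \<sigma> = adj 2 \<circ> adj 1 \<and> p = \<epsilon> (d 1) (d 2) * \<epsilon> (d 1) (d 3)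
    \<or> \<sigma> = adj 2 \<circ> (adj 1 \<circ> adj 2) \<and> p = \<epsilon> (d 2) (d 3) * \<epsilon> (d 1) (d 3) * \<epsilon> (d 1) (d 2)"
  using assms
proof induction
  case has_parity_id
  then show ?case by simp
next
  case (has_parity_step \<tau> p i)
  have c: "a * \<epsilon> \<alpha> \<beta> * \<epsilon> \<beta> \<alpha> = a" for a \<alpha> \<beta>
    by (simp add: mult.assoc skew)
  have c': "\<epsilon> \<alpha> \<beta> * a * \<epsilon> \<beta> \<alpha> = a" for a \<alpha> \<beta>
    by (metis c mult.commute)
  have e: "1 + 1 = (2::nat)" "2 + 1 = (3::nat)" by simp_all
  from has_parity_step.hyps(2) consider "i = 1" | "i = 2" by blast
  then show ?case
  proof cases
    case 1
    show ?thesis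
      using has_parity_step.IH unfolding 1 e
      apply (elim disjE conjE)
           apply (simp_all only: act_words comp_id adj_involutive skew c c' adj_braid mult_1_left simp_thms)
       apply (simp_all add: mult_ac skew)
      done
  next
    case 2
    show ?thesis
      using has_parity_step.IH unfolding 2 e
      apply (elim disjE conjE)
           apply (simp_all only: act_words comp_id adj_involutive skew c c' mult_1_left simp_thms)
      done
  qed
qed

lemma (in bicharacter) has_parity_unique:
  assumes "has_parity \<epsilon> d \<sigma> p" "has_parity \<epsilon> d \<sigma> q"
  shows "p = q"
  using has_parity_cases[OF assms(1)] has_parity_cases[OF assms(2)] adj_distinct
  unfolding distinct.simps list.set by (elim disjE conjE) (simp_all only: simp_thms insert_iff)

lemma (in bicharacter) parity_eqI: "has_parity \<epsilon> d \<sigma> p \<Longrightarrow> parity \<epsilon> \<sigma> d = p"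
  unfolding parity_def using has_parity_unique by blast

lemma (in bicharacter) parity_table:
  "parity \<epsilon> id d = 1"
  "parity \<epsilon> (adj 1) d = \<epsilon> (d 1) (d 2)"
  "parity \<epsilon> (adj 2) d = \<epsilon> (d 2) (d 3)"
  "parity \<epsilon> (adj 1 \<circ> adj 2) d = \<epsilon> (d 2) (d 3) * \<epsilon> (d 1) (d 3)"
  "parity \<epsilon> (adj 2 \<circ> adj 1) d = \<epsilon> (d 1) (d 2) * \<epsilon> (d 1) (d 3)"
  "parity \<epsilon> (adj 2 \<circ> (adj 1 \<circ> adj 2)) d = \<epsilon> (d 2) (d 3) * \<epsilon> (d 1) (d 3) * \<epsilon> (d 1) (d 2)"
proof -
  have e: "1 + 1 = (2::nat)" "2 + 1 = (3::nat)" by simp_all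
  have 1: "has_parity \<epsilon> d (adj 1 \<circ> \<tau>) (p * \<epsilon> (act \<tau> d 1) (act \<tau> d 2))"
    if "has_parity \<epsilon> d \<tau> p" for \<tau> p
    using has_parity_step[OF that, of 1] unfolding e by simp
  have 2: "has_parity \<epsilon> d (adj 2 \<circ> \<tau>) (p * \<epsilon> (act \<tau> d 2) (act \<tau> d 3))"
    if "has_parity \<epsilon> d \<tau> p" for \<tau> p
    using has_parity_step[OF that, of 2] unfolding e by simp
  note i = has_parity_id[of \<epsilon> d]
  note r = act_words comp_id mult_1_left
  show "parity \<epsilon> id d = 1"
    by (rule parity_eqI[OF i])
  show "parity \<epsilon> (adj 1) d = \<epsilon> (d 1) (d 2)"
    using parity_eqI[OF 1[OF i]] by (simp only: r)
  show "parity \<epsilon> (adj 2) d = \<epsilon> (d 2) (d 3)"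
    using parity_eqI[OF 2[OF i]] by (simp only: r)
  show "parity \<epsilon> (adj 1 \<circ> adj 2) d = \<epsilon> (d 2) (d 3) * \<epsilon> (d 1) (d 3)"
    using parity_eqI[OF 1[OF 2[OF i]]] by (simp only: r)
  show "parity \<epsilon> (adj 2 \<circ> adj 1) d = \<epsilon> (d 1) (d 2) * \<epsilon> (d 1) (d 3)"
    using parity_eqI[OF 2[OF 1[OF i]]] by (simp only: r)
  show "parity \<epsilon> (adj 2 \<circ> (adj 1 \<circ> adj 2)) d
      = \<epsilon> (d 2) (d 3) * \<epsilon> (d 1) (d 3) * \<epsilon> (d 1) (d 2)"
    using parity_eqI[OF 2[OF 1[OF 2[OF i]]]] by (simp only: r)
qed

context graded_vector_space
begin

lemma decomposition_homogeneous_part: "is_decomposition V v (homogeneous_part V v)"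
  unfolding homogeneous_part_def by (rule theI'[OF direct_sum])

lemma homogeneous_part_mem: "homogeneous_part V v \<alpha> \<in> V \<alpha>"
  and finite_homogeneous_part: "finite {\<alpha>. homogeneous_part V v \<alpha> \<noteq> 0}"
  and sum_homogeneous_part: "v = (\<Sum>\<alpha> | homogeneous_part V v \<alpha> \<noteq> 0. homogeneous_part V v \<alpha>)"
  using decomposition_homogeneous_part[of v] unfolding is_decomposition_def by blast+

lemma homogeneous_part_eqI:
  assumes "finite A" "\<And>\<alpha>. f \<alpha> \<in> V \<alpha>" "\<And>\<alpha>. \<alpha> \<notin> A \<Longrightarrow> f \<alpha> = 0" "v = sum f A"
  shows "homogeneous_part V v = f"
proof -
  have sub: "{\<alpha>. f \<alpha> \<noteq> 0} \<subseteq> A" using assms(3) by blast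
  moreover have "sum f A = (\<Sum>\<alpha> | f \<alpha> \<noteq> 0. f \<alpha>)"
    by (rule sum.mono_neutral_right[OF assms(1) sub]) simp
  ultimately have "is_decomposition V v f"
    using assms unfolding is_decomposition_def by (auto intro: finite_subset)
  then show ?thesis
    using direct_sum decomposition_homogeneous_part by blast
qed

lemma homogeneous_part_sum:
  assumes "finite A" "\<And>\<alpha>. \<alpha> \<notin> A \<Longrightarrow> homogeneous_part V v \<alpha> = 0"
  shows "sum (homogeneous_part V v) A = v"
proof -
  have "sum (homogeneous_part V v) A
      = (\<Sum>\<alpha> | homogeneous_part V v \<alpha> \<noteq> 0. homogeneous_part V v \<alpha>)"
    by (rule sum.mono_neutral_right) (use assms in auto)
  then show ?thesis using sum_homogeneous_part[of v] by simp
qed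

lemma homogeneous_part_homogeneous:
  assumes "x \<in> V \<alpha>"
  shows "homogeneous_part V x = (\<lambda>\<beta>. if \<beta> = \<alpha> then x else 0)"
  by (rule homogeneous_part_eqI[of "{\<alpha>}"]) (use assms subspace_0[OF subspace_component] in auto)

lemma homogeneous_part_add:
  "homogeneous_part V (x + y) = (\<lambda>\<alpha>. homogeneous_part V x \<alpha> + homogeneous_part V y \<alpha>)"
proof -
  let ?A = "{\<alpha>. homogeneous_part V x \<alpha> \<noteq> 0} \<union> {\<alpha>. homogeneous_part V y \<alpha> \<noteq> 0}"
  have f: "finite ?A" using finite_homogeneous_part by blast
  have "sum (homogeneous_part V x) ?A = x" "sum (homogeneous_part V y) ?A = y"
    by (rule homogeneous_part_sum[OF f]; blast)+
  then have "x + y = (\<Sum>\<alpha>\<in>?A. homogeneous_part V x \<alpha> + homogeneous_part V y \<alpha>)"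
    by (simp only: sum.distrib)
  then show ?thesis
    by (rule homogeneous_part_eqI[OF f _ _, rotated 2])
      (simp_all add: subspace_add[OF subspace_component] homogeneous_part_mem)
qed

lemma homogeneous_part_scale:
  "homogeneous_part V (scale c x) = (\<lambda>\<alpha>. scale c (homogeneous_part V x \<alpha>))"
proof -
  let ?A = "{\<alpha>. homogeneous_part V x \<alpha> \<noteq> 0}"
  have "scale c x = scale c (sum (homogeneous_part V x) ?A)"
    by (simp only: sum_homogeneous_part[symmetric])
  also have "\<dots> = (\<Sum>\<alpha>\<in>?A. scale c (homogeneous_part V x \<alpha>))"
    by (rule scale_sum_right)
  finally show ?thesis
    by (rule homogeneous_part_eqI[OF finite_homogeneous_part _ _, rotated 2])
      (simp_all add: subspace_scale[OF subspace_component] homogeneous_part_mem)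
qed

end

lemma (in vector_space) bilinear_map_iff:
  "bilinear_map scale b \<longleftrightarrow>
     (\<forall>x y y'. b x (y + y') = b x y + b x y') \<and> (\<forall>c x y. b x (scale c y) = scale c (b x y)) \<and>
     (\<forall>x x' y. b (x + x') y = b x y + b x' y) \<and> (\<forall>c x y. b (scale c x) y = scale c (b x y))"
  unfolding bilinear_map_def Vector_Spaces.linear_iff using vector_space_axioms by blast

lemma (in vector_space) bilinear_map_sums:
  assumes "bilinear_map scale b"
  shows "b (sum f A) (sum g B) = (\<Sum>\<alpha>\<in>A. \<Sum>\<beta>\<in>B. b (f \<alpha>) (g \<beta>))"
proof -
  have "module_hom scale scale (b x)" "module_hom scale scale (\<lambda>x. b x y)" for x y
    using assms unfolding bilinear_map_def linear_iff_module_hom by blast+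
  then show ?thesis
    by (simp only: module_hom.sum[of scale scale "\<lambda>x. b x y" for y] module_hom.sum[of scale scale "b x" for x])
      (rule sum.swap)
qed

context hom_color_algebra
begin

lemma mu_rules:
  "\<mu> x (y + y') = \<mu> x y + \<mu> x y'" "\<mu> x (scale c y) = scale c (\<mu> x y)"
  "\<mu> (x + x') y = \<mu> x y + \<mu> x' y" "\<mu> (scale c x) y = scale c (\<mu> x y)"
  using mu_bilinear unfolding bilinear_map_iff by blast+

lemma mu_zero: "\<mu> x 0 = 0" "\<mu> 0 y = 0"
  using mu_rules(2)[of x 0 0] mu_rules(4)[of 0 0 y] by simp_all

lemma color_commutator_alt:
  assumes "finite A" "\<And>\<alpha>. \<alpha> \<notin> A \<Longrightarrow> homogeneous_part V x \<alpha> = 0"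
    "finite B" "\<And>\<beta>. \<beta> \<notin> B \<Longrightarrow> homogeneous_part V y \<beta> = 0"
  shows "color_commutator scale V \<epsilon> \<mu> x y =
    (\<Sum>\<alpha>\<in>A. \<Sum>\<beta>\<in>B. \<mu> (homogeneous_part V x \<alpha>) (homogeneous_part V y \<beta>)
       - scale (\<epsilon> \<alpha> \<beta>) (\<mu> (homogeneous_part V y \<beta>) (homogeneous_part V x \<alpha>)))"
proof -
  let ?t = "\<lambda>\<alpha> \<beta>. \<mu> (homogeneous_part V x \<alpha>) (homogeneous_part V y \<beta>)
       - scale (\<epsilon> \<alpha> \<beta>) (\<mu> (homogeneous_part V y \<beta>) (homogeneous_part V x \<alpha>))"
  let ?A = "{\<alpha>. homogeneous_part V x \<alpha> \<noteq> 0}" and ?B = "{\<beta>. homogeneous_part V y \<beta> \<noteq> 0}"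
  have "(\<Sum>\<beta>\<in>B. ?t \<alpha> \<beta>) = (\<Sum>\<beta>\<in>?B. ?t \<alpha> \<beta>)" for \<alpha>
    by (rule sum.mono_neutral_right[OF assms(3)]) (use assms(4) in \<open>auto simp: mu_zero\<close>)
  moreover have "(\<Sum>\<alpha>\<in>A. \<Sum>\<beta>\<in>?B. ?t \<alpha> \<beta>) = (\<Sum>\<alpha>\<in>?A. \<Sum>\<beta>\<in>?B. ?t \<alpha> \<beta>)"
    by (rule sum.mono_neutral_right[OF assms(1)]) (use assms(2) in \<open>auto simp: mu_zero\<close>)
  ultimately show ?thesis
    unfolding color_commutator_def Let_def by simp
qed

lemma color_commutator_homogeneous:
  assumes "x \<in> V \<alpha>" "y \<in> V \<beta>"
  shows "color_commutator scale V \<epsilon> \<mu> x y = \<mu> x y - scale (\<epsilon> \<alpha> \<beta>) (\<mu> y x)"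
  by (subst color_commutator_alt[of "{\<alpha>}" _ "{\<beta>}"])
    (simp_all add: homogeneous_part_homogeneous[OF assms(1)] homogeneous_part_homogeneous[OF assms(2)])

lemma color_commutator_bilinear: "bilinear_map scale (color_commutator scale V \<epsilon> \<mu>)"
proof -
  define S where "S v = {\<alpha>. homogeneous_part V v \<alpha> \<noteq> 0}" for v
  have S: "finite (S v)" "\<alpha> \<notin> S v \<Longrightarrow> homogeneous_part V v \<alpha> = 0" for v \<alpha>
    unfolding S_def using finite_homogeneous_part by auto
  define t where "t x y \<alpha> \<beta> = \<mu> (homogeneous_part V x \<alpha>) (homogeneous_part V y \<beta>)
       - scale (\<epsilon> \<alpha> \<beta>) (\<mu> (homogeneous_part V y \<beta>) (homogeneous_part V x \<alpha>))" for x y \<alpha> \<beta>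
  let ?br = "color_commutator scale V \<epsilon> \<mu>"
  have br: "?br x y = (\<Sum>\<alpha>\<in>A. \<Sum>\<beta>\<in>B. t x y \<alpha> \<beta>)"
    if "finite A" "finite B" "S x \<subseteq> A" "S y \<subseteq> B" for x y A B
    unfolding t_def by (rule color_commutator_alt) (use that S(2) in blast)+
  have t: "t x (y + y') \<alpha> \<beta> = t x y \<alpha> \<beta> + t x y' \<alpha> \<beta>"
    "t (x + x') y \<alpha> \<beta> = t x y \<alpha> \<beta> + t x' y \<alpha> \<beta>"
    "t x (scale c y) \<alpha> \<beta> = scale c (t x y \<alpha> \<beta>)"
    "t (scale c x) y \<alpha> \<beta> = scale c (t x y \<alpha> \<beta>)" for x x' y y' c \<alpha> \<beta>
    by (simp_all add: t_def homogeneous_part_add homogeneous_part_scale mu_rules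
        scale_right_distrib scale_right_diff_distrib scale_left_commute[of c])
  have "?br x (y + y') = ?br x y + ?br x y'" for x y y'
    by (subst (1 2 3) br[of "S x" "S y \<union> S y' \<union> S (y + y')"])
      (simp_all add: S(1) t sum.distrib le_supI1)
  moreover have "?br (x + x') y = ?br x y + ?br x' y" for x x' y
    by (subst (1 2 3) br[of "S x \<union> S x' \<union> S (x + x')" "S y"])
      (simp_all add: S(1) t sum.distrib le_supI1)
  moreover have "?br x (scale c y) = scale c (?br x y)" for c x y
    by (subst (1 2) br[of "S x" "S y \<union> S (scale c y)"])
      (simp_all add: S(1) t scale_sum_right)
  moreover have "?br (scale c x) y = scale c (?br x y)" for c x y
    by (subst (1 2) br[of "S x \<union> S (scale c x)" "S y"])
      (simp_all add: S(1) t scale_sum_right)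
  ultimately show ?thesis
    unfolding bilinear_map_iff by blast
qed

lemma color_commutator_unique:
  assumes b: "bilinear_map scale b"
    and h: "\<And>\<alpha> \<beta> x y. x \<in> V \<alpha> \<Longrightarrow> y \<in> V \<beta> \<Longrightarrow> b x y = \<mu> x y - scale (\<epsilon> \<alpha> \<beta>) (\<mu> y x)"
  shows "b = color_commutator scale V \<epsilon> \<mu>"
proof (intro ext)
  fix x y
  have "b x y = b (\<Sum>\<alpha> | homogeneous_part V x \<alpha> \<noteq> 0. homogeneous_part V x \<alpha>)
                  (\<Sum>\<beta> | homogeneous_part V y \<beta> \<noteq> 0. homogeneous_part V y \<beta>)"
    using sum_homogeneous_part by metis
  also have "\<dots> = color_commutator scale V \<epsilon> \<mu> x y"
    unfolding bilinear_map_sums[OF b] color_commutator_def Let_def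
    by (intro sum.cong refl h homogeneous_part_mem)
  finally show "b x y = color_commutator scale V \<epsilon> \<mu> x y" .
qed

end

end

theory Submission
  imports Defs
begin

text \<open>The signed terms of the $G$-sum form a cocycle: the term of \<open>\<sigma> \<circ> \<tau>\<close> at a triple is
  \<open>sign \<tau>\<close> times the parity of \<open>\<tau>\<close> times the term of \<open>\<sigma>\<close> at the triple permuted by \<open>\<tau>\<close>. Summing
  over \<open>\<sigma> \<in> G\<close> gives 0, and summing the result over all \<open>\<tau>\<close> counts every element of $S_3$
  $|G|$ times. In characteristic zero the case of $G$ thus reduces to that of $S_3$, where the
  sum is the Hom-Jacobi expression up to the factor \<open>\<epsilon> z x\<close>.\<close>

text \<open>The words are bracketed exactly as in \<open>adj_distinct\<close>,
  \<open>parity_table\<close> and \<open>act_words\<close> rewriting, so that those facts apply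
  syntactically.\<close>

definition S3_words :: "(nat \<Rightarrow> nat) list" where
  "S3_words = [id, adj 1, adj 2, adj 1 \<circ> adj 2, adj 2 \<circ> adj 1, adj 2 \<circ> (adj 1 \<circ> adj 2)]"

lemma adj_permutes: "adj 1 permutes {1..3}" "adj 2 permutes {1..3}"
  unfolding adj_def by (rule permutes_swap_id; simp)+

text \<open>Every word permutes the three positions, and both sets have six elements because the
  words are pairwise distinct.\<close>

lemma permutes_3_eq_words: "{\<sigma>. \<sigma> permutes {1..3::nat}} = set S3_words"
proof (rule card_subset_eq[symmetric])
  show "finite {\<sigma>. \<sigma> permutes {1..3::nat}}"
    by (rule finite_permutations) simp
  show "set S3_words \<subseteq> {\<sigma>. \<sigma> permutes {1..3}}"
    unfolding S3_words_def
    by (auto simp del: One_nat_def atLeastAtMost_iff intro!: adj_permutes permutes_compose permutes_id)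
  show "card (set S3_words) = card {\<sigma>. \<sigma> permutes {1..3::nat}}"
    using distinct_card[OF adj_distinct] card_permutations[of "{1..3::nat}" 3]
    by (simp add: S3_words_def fact_numeral)
qed

lemma sign_adj: "sign (adj i) = -1"
  unfolding adj_def by (simp add: sign_swap_id)

lemma permutation_adj: "permutation (adj i)"
  unfolding adj_def by (rule permutation_swap_id)

lemma sign_table:
  "sign (id :: nat \<Rightarrow> nat) = 1" "sign (adj 1) = -1" "sign (adj 2) = -1"
  "sign (adj 1 \<circ> adj 2) = 1" "sign (adj 2 \<circ> adj 1) = 1"
  "sign (adj 2 \<circ> (adj 1 \<circ> adj 2)) = -1"
  by (simp_all only: sign_compose permutation_compose permutation_adj sign_adj sign_id
      mult_minus1 minus_minus)

lemma has_parity_bij: "has_parity \<epsilon> d \<sigma> p \<Longrightarrow> bij \<sigma>"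
  by (induction rule: has_parity.induct) (simp_all only: bij_id bij_comp bij_adj)

text \<open>A word for \<open>\<sigma>\<close> is put in front of a word for \<open>\<tau>\<close>:
  its factors are then read off the triple of degrees already permuted by \<open>\<tau>\<close>, so
  the two products multiply.\<close>

lemma has_parity_comp:
  assumes "has_parity \<epsilon> (act \<tau> d) \<sigma> p" "has_parity \<epsilon> d \<tau> q"
  shows "has_parity \<epsilon> d (\<sigma> \<circ> \<tau>) (q * p)"
  using assms(1)
proof induction
  case has_parity_id
  then show ?case using assms(2) by simp
next
  case (has_parity_step \<rho> p i)
  show ?case
    \<comment> \<open>The new factor is evaluated at \<open>act (\<rho> \<circ> \<tau>) d\<close>,
      which is \<open>act \<rho> (act \<tau> d)\<close>; \<open>act_comp\<close> asks for bijections
      here because \<open>act\<close> uses the inverse.\<close>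
    using has_parity.has_parity_step[OF has_parity_step.IH has_parity_step.hyps(2)]
    by (simp only: act_comp[OF has_parity_bij[OF has_parity_step.hyps(1)]
          has_parity_bij[OF assms(2)]] comp_assoc mult.assoc)
qed

text \<open>Together with \<open>has_parity_unique\<close> this makes the description in
  \<open>parity\<close> meaningful on all of $S_3$.\<close>

lemma has_parity_exists:
  assumes "\<sigma> permutes {1..3}"
  shows "\<exists>p. has_parity \<epsilon> d \<sigma> p"
proof -
  have s: "\<exists>p. has_parity \<epsilon> d (adj i \<circ> \<tau>) p" if "\<exists>p. has_parity \<epsilon> d \<tau> p" "i \<in> {1, 2}" for i \<tau>
    using that has_parity_step by blast
  have i: "\<exists>p. has_parity \<epsilon> d id p"
    using has_parity_id by blast
  have g: "\<exists>p. has_parity \<epsilon> d (adj i) p" if "i \<in> {1, 2}" for i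
    using s[OF i that] by simp
  have "\<sigma> \<in> set S3_words"
    using assms permutes_3_eq_words by blast
  then show ?thesis
    unfolding S3_words_def using i g s by fastforce
qed

lemma (in bicharacter) parity_comp:
  assumes "\<sigma> permutes {1..3}" "\<tau> permutes {1..3}"
  shows "parity \<epsilon> (\<sigma> \<circ> \<tau>) d = parity \<epsilon> \<tau> d * parity \<epsilon> \<sigma> (act \<tau> d)"
proof -
  obtain q where q: "has_parity \<epsilon> d \<tau> q"
    using has_parity_exists[OF assms(2)] by blast
  obtain p where p: "has_parity \<epsilon> (act \<tau> d) \<sigma> p"
    using has_parity_exists[OF assms(1)] by blast
  show ?thesis
    using parity_eqI[OF has_parity_comp[OF p q]] parity_eqI[OF p] parity_eqI[OF q] by simp
qed

lemma G_hom_associative_S3: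
  fixes \<epsilon> :: "'g::ab_group_add \<Rightarrow> 'g \<Rightarrow> 'f::field_char_0"
  assumes "bicharacter \<epsilon>" and "vector_space scale"
    and G: "subgroup G (sym_group 3)"
    and assoc: "G_hom_associative scale V \<epsilon> \<mu> \<zeta> G"
  shows "G_hom_associative scale V \<epsilon> \<mu> \<zeta> {\<sigma>. \<sigma> permutes {1..3}}"
  unfolding G_hom_associative_def
proof (intro allI impI)
  fix d :: "nat \<Rightarrow> 'g" and x
  assume x: "\<forall>i\<in>{1..3}. x i \<in> V (d i)"
  interpret bicharacter \<epsilon> by fact
  interpret vector_space scale by fact
  let ?S = "{\<sigma>. \<sigma> permutes {1..3::nat}}"
  define F where "F d x \<sigma> = scale (of_int (sign \<sigma>) * parity \<epsilon> \<sigma> d)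
      (hom_associator \<mu> \<zeta> (act \<sigma> x 1) (act \<sigma> x 2) (act \<sigma> x 3))" for d x \<sigma>
  have sub: "G \<subseteq> ?S"
    using subgroup.subset[OF G] by (simp add: sym_group_def)
  have fin: "finite ?S"
    by (rule finite_permutations) simp
  \<comment> \<open>$G$ is finite and contains the identity; in characteristic zero its order is
    then an invertible scalar.\<close>
  have ne: "card G \<noteq> 0"
    using subgroup.one_closed[OF G] finite_subset[OF sub fin] by auto
  have cocycle: "F d x (\<sigma> \<circ> \<tau>) = scale (of_int (sign \<tau>) * parity \<epsilon> \<tau> d) (F (act \<tau> d) (act \<tau> x) \<sigma>)"
    if "\<sigma> \<in> G" "\<tau> \<in> ?S" for \<sigma> \<tau>
  proof -
    have p: "\<sigma> permutes {1..3}" "\<tau> permutes {1..3}" using that sub by auto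
    then have "permutation \<sigma>" "permutation \<tau>"
      by (auto intro: permutes_imp_permutation[rotated])
    then have "sign (\<sigma> \<circ> \<tau>) = sign \<sigma> * sign \<tau>"
      by (rule sign_compose)
    then show ?thesis
      by (simp add: F_def parity_comp[OF p] act_comp[OF p[THEN permutes_bij]] mult_ac)
  qed
  \<comment> \<open>The permuted triple is again homogeneous, with degrees
    \<open>act \<tau> d\<close>, so the hypothesis on $G$ applies to it.\<close>
  have G0: "sum (F (act \<tau> d) (act \<tau> x)) G = 0" if \<tau>: "\<tau> \<in> ?S" for \<tau>
  proof -
    have "Hilbert_Choice.inv \<tau> i \<in> {1..3}" if "i \<in> {1..3}" for i
      using permutes_in_image[OF permutes_inv, of \<tau> "{1..3}" i] \<tau> that by blast
    then have "\<forall>i\<in>{1..3}. act \<tau> x i \<in> V (act \<tau> d i)"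
      using x by (simp add: act_def)
    then show ?thesis
      using assoc unfolding G_hom_associative_def F_def by blast
  qed
  \<comment> \<open>Left translation by \<open>\<sigma>\<close> is a bijection of $S_3$.\<close>
  have translate: "(\<Sum>\<tau>\<in>?S. F d x (\<sigma> \<circ> \<tau>)) = sum (F d x) ?S" if "\<sigma> \<in> G" for \<sigma>
    using setum_permutations_compose_left[of \<sigma> "{1..3}" "F d x"] that sub by auto
  have "scale (of_nat (card G)) (sum (F d x) ?S) = (\<Sum>\<sigma>\<in>G. \<Sum>\<tau>\<in>?S. F d x (\<sigma> \<circ> \<tau>))"
    by (simp only: sum.cong[OF refl translate] sum_constant_scale)
  also have "\<dots> = (\<Sum>\<tau>\<in>?S. \<Sum>\<sigma>\<in>G. F d x (\<sigma> \<circ> \<tau>))"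
    by (rule sum.swap)
  also have "\<dots> = (\<Sum>\<tau>\<in>?S. scale (of_int (sign \<tau>) * parity \<epsilon> \<tau> d)
      (sum (F (act \<tau> d) (act \<tau> x)) G))"
    by (simp add: cocycle scale_sum_right)
  also have "\<dots> = 0"
    by (simp only: G0 scale_zero_right sum.neutral_const cong: sum.cong)
  finally show "(\<Sum>\<sigma>\<in>?S. scale (of_int (sign \<sigma>) * parity \<epsilon> \<sigma> d)
       (hom_associator \<mu> \<zeta> (act \<sigma> x 1) (act \<sigma> x 2) (act \<sigma> x 3))) = 0"
    using ne by (simp only: F_def[symmetric] scale_eq_0_iff of_nat_eq_0_iff simp_thms)
qed

context hom_color_algebra
begin

lemma mu_diff: "\<mu> x (y - y') = \<mu> x y - \<mu> x y'" "\<mu> (x - x') y = \<mu> x y - \<mu> x' y"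
  using mu_rules(1)[of x "y - y'" y'] mu_rules(3)[of "x - x'" x' y]
  by (simp_all add: algebra_simps)

lemma S3_sum_homogeneous:
  fixes \<epsilon> :: "'g \<Rightarrow> 'g \<Rightarrow> 'f"
  assumes "bicharacter \<epsilon>" and assoc: "G_hom_associative scale V \<epsilon> \<mu> \<zeta> {\<sigma>. \<sigma> permutes {1..3}}"
    and xyz: "x \<in> V \<alpha>" "y \<in> V \<beta>" "z \<in> V \<gamma>"
  shows "hom_associator \<mu> \<zeta> x y z
    - scale (\<epsilon> \<alpha> \<beta>) (hom_associator \<mu> \<zeta> y x z)
    - scale (\<epsilon> \<beta> \<gamma>) (hom_associator \<mu> \<zeta> x z y)
    + scale (\<epsilon> \<beta> \<gamma> * \<epsilon> \<alpha> \<gamma>) (hom_associator \<mu> \<zeta> z x y)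
    + scale (\<epsilon> \<alpha> \<beta> * \<epsilon> \<alpha> \<gamma>) (hom_associator \<mu> \<zeta> y z x)
    - scale (\<epsilon> \<beta> \<gamma> * \<epsilon> \<alpha> \<gamma> * \<epsilon> \<alpha> \<beta>) (hom_associator \<mu> \<zeta> z y x) = 0"
proof -
  interpret bicharacter \<epsilon> by fact
  \<comment> \<open>The triples become functions on all of \<open>nat\<close>; the values outside
    positions 1, 2, 3 are arbitrary fillers.\<close>
  define d :: "nat \<Rightarrow> 'g" where "d i = (if i = 1 then \<alpha> else if i = 2 then \<beta> else \<gamma>)" for i
  define t where "t i = (if i = 1 then x else if i = 2 then y else z)" for i :: nat
  have dt: "d 1 = \<alpha>" "d 2 = \<beta>" "d 3 = \<gamma>" "t 1 = x" "t 2 = y" "t 3 = z"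
    by (simp_all add: d_def t_def)
  have "{1..3::nat} = {1, 2, 3}" by auto
  then have mem: "\<forall>i\<in>{1..3}. t i \<in> V (d i)"
    using xyz dt by (simp only: ball_simps simp_thms)
  have "(\<Sum>\<sigma>\<in>set S3_words. scale (of_int (sign \<sigma>) * parity \<epsilon> \<sigma> d)
           (hom_associator \<mu> \<zeta> (act \<sigma> t 1) (act \<sigma> t 2) (act \<sigma> t 3))) = 0"
    using assoc mem unfolding G_hom_associative_def permutes_3_eq_words by blast
  also have "(\<Sum>\<sigma>\<in>set S3_words. scale (of_int (sign \<sigma>) * parity \<epsilon> \<sigma> d)
           (hom_associator \<mu> \<zeta> (act \<sigma> t 1) (act \<sigma> t 2) (act \<sigma> t 3)))
    = (\<Sum>\<sigma>\<leftarrow>S3_words. scale (of_int (sign \<sigma>) * parity \<epsilon> \<sigma> d)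
           (hom_associator \<mu> \<zeta> (act \<sigma> t 1) (act \<sigma> t 2) (act \<sigma> t 3)))"
    \<comment> \<open>Distinctness of the words turns the sum over a set into a list sum, which
      unfolds into six explicit terms.\<close>
    by (rule sum.distinct_set_conv_list) (simp only: S3_words_def adj_distinct)
  finally have "hom_associator \<mu> \<zeta> x y z
    + (scale (- \<epsilon> \<alpha> \<beta>) (hom_associator \<mu> \<zeta> y x z)
    + (scale (- \<epsilon> \<beta> \<gamma>) (hom_associator \<mu> \<zeta> x z y)
    + (scale (\<epsilon> \<beta> \<gamma> * \<epsilon> \<alpha> \<gamma>) (hom_associator \<mu> \<zeta> z x y)
    + (scale (\<epsilon> \<alpha> \<beta> * \<epsilon> \<alpha> \<gamma>) (hom_associator \<mu> \<zeta> y z x)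
    + scale (- (\<epsilon> \<beta> \<gamma> * \<epsilon> \<alpha> \<gamma> * \<epsilon> \<alpha> \<beta>)) (hom_associator \<mu> \<zeta> z y x))))) = 0"
    by (simp only: S3_words_def list.map sum_list.Cons sum_list.Nil sign_table parity_table
        act_words dt of_int_1 of_int_minus mult_1_left mult_minus1 scale_one add_0_right)
  then show ?thesis
    by (simp only: scale_minus_left add.assoc diff_conv_add_uminus)
qed

text \<open>Each of the three nested brackets expands into four products and each of the six
  associators into two. The same twelve products arise on both sides, and skewness of
  \<open>\<epsilon>\<close> matches their coefficients.\<close>

lemma hom_jacobi_S3:
  fixes \<epsilon> :: "'g \<Rightarrow> 'g \<Rightarrow> 'f"
  defines "br \<equiv> color_commutator scale V \<epsilon> \<mu>"
  assumes "bicharacter \<epsilon>" and xyz: "x \<in> V \<alpha>" "y \<in> V \<beta>" "z \<in> V \<gamma>"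
  shows "scale (\<epsilon> \<gamma> \<alpha>) (br (\<zeta> x) (br y z)) + scale (\<epsilon> \<alpha> \<beta>) (br (\<zeta> y) (br z x))
      + scale (\<epsilon> \<beta> \<gamma>) (br (\<zeta> z) (br x y))
    = scale (\<epsilon> \<gamma> \<alpha>) (hom_associator \<mu> \<zeta> x y z
      - scale (\<epsilon> \<alpha> \<beta>) (hom_associator \<mu> \<zeta> y x z)
      - scale (\<epsilon> \<beta> \<gamma>) (hom_associator \<mu> \<zeta> x z y)
      + scale (\<epsilon> \<beta> \<gamma> * \<epsilon> \<alpha> \<gamma>) (hom_associator \<mu> \<zeta> z x y)
      + scale (\<epsilon> \<alpha> \<beta> * \<epsilon> \<alpha> \<gamma>) (hom_associator \<mu> \<zeta> y z x)
      - scale (\<epsilon> \<beta> \<gamma> * \<epsilon> \<alpha> \<gamma> * \<epsilon> \<alpha> \<beta>) (hom_associator \<mu> \<zeta> z y x))"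
proof -
  interpret bicharacter \<epsilon> by fact
  \<comment> \<open>The outer bracket is given by the commutator formula only if the inner one is
    homogeneous; its two products have the same degree since the grading group is abelian.\<close>
  have br_mem: "br u v \<in> V (\<alpha>' + \<beta>')" if "u \<in> V \<alpha>'" "v \<in> V \<beta>'" for u v \<alpha>' \<beta>'
    using that mu_even[of u \<alpha>' v \<beta>'] mu_even[of v \<beta>' u \<alpha>'] unfolding br_def
    by (simp add: color_commutator_homogeneous add.commute subspace_diff[OF subspace_component]
        subspace_scale[OF subspace_component])
  have br2: "br (\<zeta> u) (br v w) = \<mu> (\<zeta> u) (\<mu> v w) - scale (\<epsilon> \<beta>' \<gamma>') (\<mu> (\<zeta> u) (\<mu> w v))
      - scale (\<epsilon> \<alpha>' \<beta>' * \<epsilon> \<alpha>' \<gamma>') (\<mu> (\<mu> v w) (\<zeta> u))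
      + scale (\<epsilon> \<alpha>' \<beta>' * \<epsilon> \<alpha>' \<gamma>' * \<epsilon> \<beta>' \<gamma>') (\<mu> (\<mu> w v) (\<zeta> u))"
    if "u \<in> V \<alpha>'" "v \<in> V \<beta>'" "w \<in> V \<gamma>'" for u v w \<alpha>' \<beta>' \<gamma>'
  proof -
    have "br (\<zeta> u) (br v w) = \<mu> (\<zeta> u) (br v w) - scale (\<epsilon> \<alpha>' (\<beta>' + \<gamma>')) (\<mu> (br v w) (\<zeta> u))"
      using color_commutator_homogeneous[OF zeta_even[OF that(1)] br_mem[OF that(2,3)]]
      by (simp only: br_def)
    moreover have "br v w = \<mu> v w - scale (\<epsilon> \<beta>' \<gamma>') (\<mu> w v)"
      using color_commutator_homogeneous[OF that(2,3)] by (simp only: br_def)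
    ultimately show ?thesis
      by (simp add: mu_diff mu_rules add_right scale_right_diff_distrib)
  qed
  \<comment> \<open>All coefficients become monomials in three nonzero scalars and their
    inverses.\<close>
  have inv: "\<epsilon> \<beta> \<alpha> = inverse (\<epsilon> \<alpha> \<beta>)" "\<epsilon> \<gamma> \<beta> = inverse (\<epsilon> \<beta> \<gamma>)" "\<epsilon> \<gamma> \<alpha> = inverse (\<epsilon> \<alpha> \<gamma>)"
    by (metis inverse_unique skew)+
  \<comment> \<open>Reordering by \<open>mult_ac\<close> can leave one factor between a scalar and
    its inverse; these rules cancel across it.\<close>
  have cancel: "a * (b * inverse a) = b" "a * (b * (inverse a * c)) = b * c" if "a \<noteq> 0"
    for a b c :: 'f
    using that by simp_all
  show ?thesis
    unfolding br2[OF xyz] br2[OF xyz(2,3,1)] br2[OF xyz(3,1,2)] inv hom_associator_def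
    by (simp add: scale_right_diff_distrib scale_right_distrib nonzero cancel mult_ac)
qed

end

theorem proposition5p33:
  fixes \<epsilon> :: "'g::ab_group_add \<Rightarrow> 'g \<Rightarrow> 'f::field_char_0"
    and scale :: "'f \<Rightarrow> 'v::ab_group_add \<Rightarrow> 'v"
    and V :: "'g \<Rightarrow> 'v set"
    and \<mu> :: "'v \<Rightarrow> 'v \<Rightarrow> 'v"
    and \<zeta> :: "'v \<Rightarrow> 'v"
    and G :: "(nat \<Rightarrow> nat) set"
  assumes "bicharacter \<epsilon>"
    and "hom_color_algebra scale V \<mu> \<zeta>"
    and "subgroup G (sym_group 3)"
    and "G_hom_associative scale V \<epsilon> \<mu> \<zeta> G"
  shows "hom_lie_color_admissible scale V \<epsilon> \<mu> \<zeta>"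
proof -
  interpret hom_color_algebra scale V \<mu> \<zeta> by fact
  have "G_hom_associative scale V \<epsilon> \<mu> \<zeta> {\<sigma>. \<sigma> permutes {1..3}}"
    by (rule G_hom_associative_S3[OF assms(1) vector_space_axioms assms(3,4)])
  \<comment> \<open>By \<open>hom_jacobi_S3\<close> the Hom-Jacobi expression is a scalar multiple
    of this vanishing sum.\<close>
  from S3_sum_homogeneous[OF assms(1) this] show ?thesis
    unfolding hom_lie_color_admissible_def Let_def
    by (intro allI impI) (simp only: hom_jacobi_S3[OF assms(1)] scale_zero_right)
qed

end
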